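(* Let $R$ be a ring with zero characteristic. If there exists a natural number $n>1$ such that $\frac{1}{n}\in R$ (i.e. $n\cdot 1_R$ is invertible in $R$), then $R$ is submaximal.
   Context: All rings are commutative with $1\neq 0$, and a subring of a ring contains the identity of that ring. A maximal subring of $R$ is a proper subring $S\subsetneq R$ such that there is no subring strictly between $S$ and $R$; $R$ is called submaximal if it has at least one maximal subring. *)

theory Defs
  imports "HOL-Algebra.Algebra"
begin

(* group.ord yields 0 for elements of infinite order, so this is the usual convention:
   characteristic 0 means that no positive multiple of the identity vanishes. *)
definition ring_char :: "('a, 'b) ring_scheme \<Rightarrow> nat" where
  "ring_char R = group.ord (add_monoid R) \<one>\<^bsub>R\<^esub>"

lemma ring_char_eq_0_iff:
  assumes "ring R"
  shows "ring_char R = 0 \<longleftrightarrow> (\<forall>n::nat. n > 0 \<longrightarrow> [n] \<cdot>\<^bsub>R\<^esub> \<one>\<^bsub>R\<^esub> \<noteq> \<zero>\<^bsub>R\<^esub>)"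
proof -
  interpret ring R by fact
  have "[n] \<cdot>\<^bsub>R\<^esub> \<one>\<^bsub>R\<^esub> = \<zero>\<^bsub>R\<^esub> \<longleftrightarrow> ring_char R dvd n" for n :: nat
    using group.pow_eq_id[OF a_group, of "\<one>\<^bsub>R\<^esub>" n]
    by (simp add: ring_char_def add_pow_def)
  then show ?thesis
    by (metis dvd_0_left_iff dvd_refl neq0_conv)
qed

definition maximal_subring :: "'a set \<Rightarrow> ('a, 'b) ring_scheme \<Rightarrow> bool" where
  "maximal_subring S R \<longleftrightarrow>
     subring S R \<and> S \<subset> carrier R \<and>
     \<not> (\<exists>T. subring T R \<and> S \<subset> T \<and> T \<subset> carrier R)"

definition submaximal :: "('a, 'b) ring_scheme \<Rightarrow> bool" where
  "submaximal R \<longleftrightarrow> (\<exists>S. maximal_subring S R)"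

end

(*
  Let p be a prime dividing n, so that q = 1/p lies in R. If a subring S misses q and S[q] = R,
  then any subring maximal among those that contain S and miss q is a maximal subring of R,
  because adjoining q to it gives R. To find S, let A be a subring, maximal for a suitable order,
  such that pA is prime and A is p-adically separated (the integers in R are one such subring, as
  the characteristic is 0). By Gauss's lemma every element r of R is then algebraic over A:
  otherwise A[r] would be larger. Removing powers of p from the leading coefficient, some p^k r
  satisfies an equation over A whose leading coefficient u is not in pA. Finally let S be maximal
  among the subrings that contain A and in which no element of A outside pA becomes divisible
  by p. Such elements can be inverted without making p a unit, so S is integrally closed enough
  to contain all these p^k r.
*)
theory Submission
  imports Defs
begin

context cring
begin

section \<open>Values of polynomials, and the subring obtained by adjoining one element\<close>

text \<open>\<open>polys S x n\<close> consists of the values at \<open>x\<close> of the polynomials over \<open>S\<close> of degree less than \<open>n\<close>.\<close>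
primrec polys :: "'a set \<Rightarrow> 'a \<Rightarrow> nat \<Rightarrow> 'a set" where
  "polys S x 0 = {\<zero>}"
| "polys S x (Suc n) = {a \<oplus> x \<otimes> f | a f. a \<in> S \<and> f \<in> polys S x n}"

lemma polys_SucI: "a \<in> S \<Longrightarrow> f \<in> polys S x n \<Longrightarrow> a \<oplus> x \<otimes> f \<in> polys S x (Suc n)"
  by auto

lemma polys_mono_coeffs: "S \<subseteq> T \<Longrightarrow> polys S x n \<subseteq> polys T x n"
  by (induction n) auto

lemma subring_closed: "subring S R \<Longrightarrow> a \<in> S \<Longrightarrow> a \<in> carrier R"
  using subringE(1) by blast

context
  fixes S x
  assumes S: "subring S R" and x: "x \<in> carrier R"
begin

lemma polys_closed: "f \<in> polys S x n \<Longrightarrow> f \<in> carrier R"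
  by (induction n arbitrary: f) (auto intro: subring_closed[OF S] x)

lemma zero_mem_polys: "\<zero> \<in> polys S x n"
proof (induction n)
  case (Suc n)
  from polys_SucI[OF subringE(2)[OF S] Suc] show ?case using x by simp
qed simp

lemma polys_Suc_mono: "f \<in> polys S x n \<Longrightarrow> f \<in> polys S x (Suc n)"
proof (induction n arbitrary: f)
  case 0
  then show ?case using zero_mem_polys by (simp del: polys.simps(2))
next
  case (Suc n)
  then obtain a g where "a \<in> S" "g \<in> polys S x n" "f = a \<oplus> x \<otimes> g" by auto
  with Suc.IH[of g] show ?case by (auto simp del: polys.simps(2) intro: polys_SucI)
qed

lemma polys_mono: "m \<le> n \<Longrightarrow> polys S x m \<subseteq> polys S x n"
  by (rule lift_Suc_mono_le[of "polys S x"]) (use polys_Suc_mono in blast)+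

lemma polys_add:
  "f \<in> polys S x n \<Longrightarrow> g \<in> polys S x n \<Longrightarrow> f \<oplus> g \<in> polys S x n"
proof (induction n arbitrary: f g)
  case (Suc n)
  then obtain a f' b g' where *: "a \<in> S" "f' \<in> polys S x n" "f = a \<oplus> x \<otimes> f'"
    "b \<in> S" "g' \<in> polys S x n" "g = b \<oplus> x \<otimes> g'" by auto
  note c = subring_closed[OF S *(1)] polys_closed[OF *(2)] subring_closed[OF S *(4)] polys_closed[OF *(5)] x
  have "f \<oplus> g = (a \<oplus> b) \<oplus> x \<otimes> (f' \<oplus> g')"
    unfolding * using c by algebra
  with polys_SucI[OF subringE(7)[OF S *(1) *(4)] Suc.IH[OF *(2) *(5)]] show ?case by simp
qed simp

lemma polys_smult: "c \<in> S \<Longrightarrow> f \<in> polys S x n \<Longrightarrow> c \<otimes> f \<in> polys S x n"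
proof (induction n arbitrary: f)
  case (Suc n)
  then obtain a f' where *: "a \<in> S" "f' \<in> polys S x n" "f = a \<oplus> x \<otimes> f'" by auto
  note c = subring_closed[OF S *(1)] polys_closed[OF *(2)] subring_closed[OF S Suc.prems(1)] x
  have "c \<otimes> f = c \<otimes> a \<oplus> x \<otimes> (c \<otimes> f')"
    unfolding * using c by algebra
  with polys_SucI[OF subringE(6)[OF S Suc.prems(1) *(1)] Suc.IH[OF Suc.prems(1) *(2)]]
  show ?case by simp
qed (simp add: subring_closed[OF S])

lemma polys_shift: "f \<in> polys S x n \<Longrightarrow> x \<otimes> f \<in> polys S x (Suc n)"
  using polys_SucI[OF subringE(2)[OF S], of f x n] polys_closed[of f n] x by simp

lemma polys_shift_pow: "f \<in> polys S x n \<Longrightarrow> x [^] k \<otimes> f \<in> polys S x (n + k)"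
proof (induction k)
  case (Suc k)
  have "x [^] Suc k \<otimes> f = x \<otimes> (x [^] k \<otimes> f)"
    using x polys_closed[OF Suc.prems] nat_pow_closed[OF x, of k] unfolding nat_pow_Suc by algebra
  then show ?case using polys_shift[OF Suc.IH[OF Suc.prems]] by simp
qed (simp add: polys_closed)

lemma polys_const: "a \<in> S \<Longrightarrow> a \<in> polys S x (Suc n)"
  using polys_SucI[OF _ zero_mem_polys, of a n] x subring_closed[OF S, of a] by simp

text \<open>The recursion for \<open>polys\<close> peels off the constant coefficient; eliminating a
  highest power needs the other end of the polynomial as well.\<close>

lemma polys_top:
  "f \<in> polys S x (Suc n) \<Longrightarrow> \<exists>c\<in>S. \<exists>g\<in>polys S x n. f = g \<oplus> c \<otimes> x [^] n"
proof (induction n arbitrary: f)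
  case 0
  then show ?case using x by (auto simp: subring_closed[OF S])
next
  case (Suc n)
  obtain a f' where *: "a \<in> S" "f' \<in> polys S x (Suc n)" "f = a \<oplus> x \<otimes> f'"
    using Suc.prems by (auto simp del: polys.simps(2) simp: polys.simps(2)[of S x "Suc n"])
  obtain c g where g: "c \<in> S" "g \<in> polys S x n" "f' = g \<oplus> c \<otimes> x [^] n"
    using Suc.IH[OF *(2)] by auto
  note cl = subring_closed[OF S *(1)] subring_closed[OF S g(1)] polys_closed[OF g(2)] x nat_pow_closed[OF x, of n]
  have "f = (a \<oplus> x \<otimes> g) \<oplus> c \<otimes> x [^] Suc n"
    unfolding * g nat_pow_Suc using cl by algebra
  with polys_SucI[OF *(1) g(2)] g(1) show ?case by blast
qed

lemma polys_mult:
  "f \<in> polys S x m \<Longrightarrow> g \<in> polys S x n \<Longrightarrow> f \<otimes> g \<in> polys S x (m + n)"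
proof (induction m arbitrary: f)
  case 0
  then show ?case using zero_mem_polys polys_closed by simp
next
  case (Suc m)
  then obtain a f' where *: "a \<in> S" "f' \<in> polys S x m" "f = a \<oplus> x \<otimes> f'" by auto
  have "f \<otimes> g = a \<otimes> g \<oplus> x \<otimes> (f' \<otimes> g)"
    unfolding * using subring_closed[OF S *(1)] polys_closed[OF *(2)] polys_closed[OF Suc.prems(2)] x
    by algebra
  moreover have "a \<otimes> g \<in> polys S x (Suc (m + n))"
    using polys_smult[OF *(1) Suc.prems(2)] polys_mono[of n "Suc (m + n)"] by auto
  moreover have "x \<otimes> (f' \<otimes> g) \<in> polys S x (Suc (m + n))"
    by (rule polys_shift[OF Suc.IH[OF *(2) Suc.prems(2)]])
  ultimately show ?case using polys_add by (simp del: polys.simps)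
qed

lemma subring_polys: "subring (\<Union>n. polys S x n) R"
proof (rule subringI)
  show "(\<Union>n. polys S x n) \<subseteq> carrier R" using polys_closed by auto
  show "\<one> \<in> (\<Union>n. polys S x n)" using polys_const[OF subringE(3)[OF S]] by blast
next
  fix f assume "f \<in> (\<Union>n. polys S x n)"
  then obtain m where m: "f \<in> polys S x m" by blast
  have "\<ominus> \<one> \<otimes> f = \<ominus> f" using polys_closed[OF m] by algebra
  then show "\<ominus> f \<in> (\<Union>n. polys S x n)"
    using polys_smult[OF subringE(5)[OF S subringE(3)[OF S]] m] by auto
next
  fix f g assume "f \<in> (\<Union>n. polys S x n)" "g \<in> (\<Union>n. polys S x n)"
  then obtain m n where m: "f \<in> polys S x m" "g \<in> polys S x n" by blast
  then have "f \<in> polys S x (max m n)" "g \<in> polys S x (max m n)"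
    using polys_mono[of m "max m n"] polys_mono[of n "max m n"] by auto
  from polys_add[OF this] show "f \<oplus> g \<in> (\<Union>n. polys S x n)" by blast
  from polys_mult[OF m] show "f \<otimes> g \<in> (\<Union>n. polys S x n)" by blast
qed

lemma subset_polys: "S \<subseteq> (\<Union>n. polys S x n)"
  using polys_const by blast

lemma mem_polys: "x \<in> (\<Union>n. polys S x n)"
proof -
  have "x \<otimes> \<one> \<in> polys S x (Suc (Suc 0))"
    by (rule polys_shift[OF polys_const[OF subringE(3)[OF S]]])
  then show ?thesis unfolding r_one[OF x] by blast
qed

section \<open>Adjoining an element that is integral up to a factor from \<open>G\<close>\<close>

text \<open>Both relations are shortened alternately until one of them reads \<open>\<zero> \<in> G\<close>.\<close>
lemma integral_no_unit:
  assumes p: "p \<in> S" and GS: "G \<subseteq> S"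
    and Gmult: "\<And>g h. g \<in> G \<Longrightarrow> h \<in> G \<Longrightarrow> g \<otimes> h \<in> G"
    and Gadd: "\<And>g a. g \<in> G \<Longrightarrow> a \<in> S \<Longrightarrow> g \<oplus> p \<otimes> a \<in> G"
    and G0: "\<zero> \<notin> G"
    and "g \<in> G" "g \<otimes> x [^] n \<in> polys S x n"
    and "h \<in> G" "t \<in> polys S x m"
  shows "h \<noteq> p \<otimes> x \<otimes> t"
  using assms(6-)
proof (induction "n + m" arbitrary: n m g h t rule: less_induct)
  case less
  note g = less.prems(1,2) and h = less.prems(3,4)
  have cl: "g \<in> carrier R" "h \<in> carrier R" "p \<in> carrier R" "t \<in> carrier R" "x \<in> carrier R"
    using g h p GS subring_closed[OF S] polys_closed x by auto
  show ?case
  proof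
    assume eq: "h = p \<otimes> x \<otimes> t"
    consider "n = 0" | "m = 0" | k where "n = Suc k" "m \<le> n" | k where "m = Suc k" "n \<le> k"
      by (cases n; cases m; cases "m \<le> n") (auto simp: not_le)
    then show False
    proof cases
      case 1
      with g cl G0 show False by auto
    next
      case 2
      with h eq cl G0 show False by auto
    next
      \<comment> \<open>Here the first relation is shortened, without cancelling \<open>x\<close>,
        which may be a zero divisor. Write \<open>g x^n = c + x l\<close> and
        \<open>y = x^k\<close>, so that \<open>x (g y - l) = c\<close>. As \<open>h\<close> carries
        a factor \<open>x\<close>, this gives \<open>h (g y - l) = p t c\<close>. Inserting
        \<open>t = r + d y\<close> and collecting the terms in \<open>y\<close> yields a relation of
        exponent \<open>k\<close> whose leading coefficient \<open>h g - p c d\<close> is again in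
        \<open>G\<close>.\<close>
      case 3
      have "g \<otimes> x [^] n \<in> polys S x (Suc k)" using g 3 by simp
      then obtain c l where c: "c \<in> S" "l \<in> polys S x k" "g \<otimes> x [^] n = c \<oplus> x \<otimes> l" by auto
      have "t \<in> polys S x (Suc k)" using h(2) 3 polys_mono[of m n] by auto
      then obtain d r where d: "d \<in> S" "r \<in> polys S x k" "t = r \<oplus> d \<otimes> x [^] k"
        using polys_top by blast
      define y where "y = x [^] k"
      have cl': "c \<in> carrier R" "d \<in> carrier R" "l \<in> carrier R" "r \<in> carrier R" "y \<in> carrier R"
        using c d subring_closed[OF S] polys_closed x by (auto simp: y_def)
      have e1: "x \<otimes> (g \<otimes> y \<ominus> l) = c"
      proof -
        have "x \<otimes> (g \<otimes> y \<ominus> l) = g \<otimes> x [^] n \<ominus> x \<otimes> l"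
          unfolding 3 nat_pow_Suc y_def[symmetric] using cl cl' by algebra
        also have "\<dots> = c" unfolding c using cl cl' by algebra
        finally show ?thesis .
      qed
      have "h \<otimes> (g \<otimes> y \<ominus> l) = p \<otimes> t \<otimes> (x \<otimes> (g \<otimes> y \<ominus> l))"
        unfolding eq using cl cl' by algebra
      then have e2: "h \<otimes> (g \<otimes> y \<ominus> l) = p \<otimes> t \<otimes> c" unfolding e1 .
      have "(h \<otimes> g \<oplus> p \<otimes> (\<ominus> (c \<otimes> d))) \<otimes> y
          = h \<otimes> (g \<otimes> y \<ominus> l) \<oplus> h \<otimes> l \<ominus> p \<otimes> c \<otimes> d \<otimes> y"
        using cl cl' by algebra
      also have "\<dots> = h \<otimes> l \<oplus> (p \<otimes> c) \<otimes> r"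
        unfolding e2 d(3) y_def[symmetric] using cl cl' by algebra
      finally have "(h \<otimes> g \<oplus> p \<otimes> (\<ominus> (c \<otimes> d))) \<otimes> x [^] k = h \<otimes> l \<oplus> (p \<otimes> c) \<otimes> r"
        unfolding y_def .
      moreover have "h \<otimes> l \<oplus> (p \<otimes> c) \<otimes> r \<in> polys S x k"
        using h GS p c d subringE(6)[OF S] by (intro polys_add polys_smult) auto
      ultimately have w: "(h \<otimes> g \<oplus> p \<otimes> (\<ominus> (c \<otimes> d))) \<otimes> x [^] k \<in> polys S x k"
        by simp
      have "h \<otimes> g \<oplus> p \<otimes> (\<ominus> (c \<otimes> d)) \<in> G"
        using h g c d subringE(5,6)[OF S] by (intro Gadd Gmult) auto
      from less.hyps[OF _ this w h] 3 have "h \<noteq> p \<otimes> x \<otimes> t" by linarith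
      with eq show False by contradiction
    next
      \<comment> \<open>Now the second relation is shortened. Multiplying it by \<open>g\<close>
        turns the top term \<open>d x^k\<close> of \<open>t\<close> into \<open>d (g x^k)\<close>,
        and since \<open>n \<le> k\<close> the first relation, multiplied by
        \<open>x^(k - n)\<close>, rewrites \<open>g x^k\<close> with degree below
        \<open>k\<close>.\<close>
      case 4
      have "t \<in> polys S x (Suc k)" using h(2) 4 by auto
      then obtain d r where d: "d \<in> S" "r \<in> polys S x k" "t = r \<oplus> d \<otimes> x [^] k"
        using polys_top by blast
      have "x [^] (k - n) \<otimes> (g \<otimes> x [^] n) \<in> polys S x (n + (k - n))"
        by (rule polys_shift_pow[OF g(2)])
      moreover have "x [^] (k - n) \<otimes> (g \<otimes> x [^] n) = g \<otimes> x [^] k"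
        using cl 4 nat_pow_mult[of x "k - n" n] by (simp add: m_lcomm)
      ultimately have gk: "g \<otimes> x [^] k \<in> polys S x k" using 4 by simp
      define y where "y = x [^] k"
      have cl': "d \<in> carrier R" "r \<in> carrier R" "y \<in> carrier R"
        using d subring_closed[OF S] polys_closed x by (auto simp: y_def)
      have e: "g \<otimes> h = p \<otimes> x \<otimes> (g \<otimes> r \<oplus> d \<otimes> (g \<otimes> y))"
        unfolding eq d(3) y_def[symmetric] using cl cl' by algebra
      have "g \<otimes> r \<oplus> d \<otimes> (g \<otimes> y) \<in> polys S x k"
        unfolding y_def using g GS d gk by (blast intro: polys_add polys_smult)
      from less.hyps[OF _ g Gmult[OF g(1) h(1)] this] 4 have "g \<otimes> h \<noteq> p \<otimes> x \<otimes> (g \<otimes> r \<oplus> d \<otimes> (g \<otimes> y))"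
        by linarith
      with e show False by contradiction
    qed
  qed
qed

end

section \<open>Subrings maximal among those that avoid a set\<close>

text \<open>Zorn's lemma, as a union of a nonempty chain of subrings is a subring. It serves twice:
  with \<open>B = {q}\<close> for the maximal subring itself, and with \<open>B\<close> the set of
  quotients \<open>m/p\<close> for \<open>m \<in> M\<close>.\<close>

lemma maximal_subring_avoiding:
  assumes A: "subring A R" "A \<inter> B = {}"
  obtains S where "subring S R" "A \<subseteq> S" "S \<inter> B = {}"
    "\<And>T. subring T R \<Longrightarrow> S \<subseteq> T \<Longrightarrow> T \<inter> B = {} \<Longrightarrow> T = S"
proof -
  define \<A> where "\<A> = {S. subring S R \<and> A \<subseteq> S \<and> S \<inter> B = {}}"
  have "\<exists>M\<in>\<A>. \<forall>N\<in>\<A>. M \<subseteq> N \<longrightarrow> N = M"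
  proof (rule subset_Zorn_nonempty)
    show "\<A> \<noteq> {}" using A unfolding \<A>_def by blast
  next
    fix \<C> assume ne: "\<C> \<noteq> {}" and ch: "subset.chain \<A> \<C>"
    from ch have sub: "\<And>S. S \<in> \<C> \<Longrightarrow> subring S R" "\<And>S. S \<in> \<C> \<Longrightarrow> A \<subseteq> S"
      "\<And>S. S \<in> \<C> \<Longrightarrow> S \<inter> B = {}"
      unfolding subset_chain_def \<A>_def by auto
    have dir: "\<exists>S\<in>\<C>. a \<in> S \<and> b \<in> S" if "a \<in> \<Union>\<C>" "b \<in> \<Union>\<C>" for a b
      using that ch unfolding subset_chain_def by blast
    have "subring (\<Union>\<C>) R"
    proof (rule subringI)
      show "\<Union>\<C> \<subseteq> carrier R" using subringE(1)[OF sub(1)] by blast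
      show "\<one> \<in> \<Union>\<C>" using ne subringE(3)[OF sub(1)] by blast
      show "\<ominus> a \<in> \<Union>\<C>" if "a \<in> \<Union>\<C>" for a
        using that subringE(5)[OF sub(1)] by blast
      show "a \<otimes> b \<in> \<Union>\<C>" if "a \<in> \<Union>\<C>" "b \<in> \<Union>\<C>" for a b
        using dir[OF that] subringE(6)[OF sub(1)] by blast
      show "a \<oplus> b \<in> \<Union>\<C>" if "a \<in> \<Union>\<C>" "b \<in> \<Union>\<C>" for a b
        using dir[OF that] subringE(7)[OF sub(1)] by blast
    qed
    then show "\<Union>\<C> \<in> \<A>" using ne sub unfolding \<A>_def by blast
  qed
  then obtain S where S: "S \<in> \<A>" "\<forall>N\<in>\<A>. S \<subseteq> N \<longrightarrow> N = S" by (rule bexE)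
  show thesis
  proof (rule that)
    show "subring S R" "A \<subseteq> S" "S \<inter> B = {}" using S(1) unfolding \<A>_def by simp_all
    then show "T = S" if "subring T R" "S \<subseteq> T" "T \<inter> B = {}" for T
      using S(2) that unfolding \<A>_def by simp
  qed
qed

text \<open>Take \<open>T\<close> maximal among the subrings that contain \<open>S\<close> and miss
  \<open>q\<close>. A strictly larger subring contains \<open>q\<close>, hence every
  \<open>r\<close>, because \<open>r = q^k (p^k r)\<close> with \<open>p^k r\<close> in
  \<open>S\<close> for some \<open>k\<close>.\<close>

lemma submaximal_if_localization:
  assumes p: "p \<in> carrier R" "q \<in> carrier R" "p \<otimes> q = \<one>"
    and S: "subring S R" "q \<notin> S"
    and loc: "\<And>r. r \<in> carrier R \<Longrightarrow> \<exists>k::nat. p [^] k \<otimes> r \<in> S"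
  shows "submaximal R"
proof -
  obtain T where T: "subring T R" "S \<subseteq> T" "T \<inter> {q} = {}"
    "\<And>U. subring U R \<Longrightarrow> T \<subseteq> U \<Longrightarrow> U \<inter> {q} = {} \<Longrightarrow> U = T"
    using maximal_subring_avoiding[of S "{q}"] S by blast
  have "carrier R \<subseteq> U" if U: "subring U R" "T \<subset> U" for U
  proof
    fix r assume r: "r \<in> carrier R"
    from T(4)[OF U(1)] U(2) have q: "q \<in> U" by blast
    obtain k :: nat where "p [^] k \<otimes> r \<in> S" using loc[OF r] by blast
    then have k: "p [^] k \<otimes> r \<in> U" using T(2) U(2) by blast
    have "q [^] k \<in> U" by (induction k) (auto intro: subringE(3,6)[OF U(1)] q)
    from subringE(6)[OF U(1) this k] have "(q [^] k \<otimes> p [^] k) \<otimes> r \<in> U"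
      using p r by (simp add: m_assoc)
    moreover have "q [^] k \<otimes> p [^] k = \<one>"
      using p by (simp add: nat_pow_distrib[symmetric] m_comm)
    ultimately show "r \<in> U" using r by simp
  qed
  moreover have "T \<subset> carrier R" using subringE(1)[OF T(1)] T(3) p by blast
  ultimately have "maximal_subring T R"
    using T(1) unfolding maximal_subring_def by blast
  then show ?thesis unfolding submaximal_def by blast
qed

section \<open>Rings that are separated in the \<open>p\<close>-adic sense, and their maximal
  members\<close>

definition adic :: "'a \<Rightarrow> 'a set \<Rightarrow> 'a set" where
  "adic p M = insert \<zero> {p [^] k \<otimes> m | (k::nat) m. m \<in> M}"

text \<open>\<open>M\<close> plays the role of the complement of the prime ideal \<open>pA\<close> in a \<open>p\<close>-adically
  separated ring \<open>A = adic p M\<close>.\<close>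
definition primitive :: "'a \<Rightarrow> 'a set \<Rightarrow> bool" where
  "primitive p M \<longleftrightarrow> M \<subseteq> carrier R \<and> \<one> \<in> M \<and> (\<forall>a\<in>M. \<forall>b\<in>M. a \<otimes> b \<in> M) \<and>
     (\<forall>a\<in>adic p M. \<forall>b\<in>adic p M. a \<ominus> b \<in> adic p M) \<and> (\<forall>m\<in>M. \<forall>a\<in>adic p M. m \<noteq> p \<otimes> a)"

lemma adic_mono: "M \<subseteq> N \<Longrightarrow> adic p M \<subseteq> adic p N"
  unfolding adic_def by blast

text \<open>Encoding the ring by \<open>M\<close> makes plain inclusion the right order for Zorn's
  lemma: if \<open>M \<subseteq> N\<close>, then the ring of \<open>N\<close> contains that of
  \<open>M\<close>, and elements outside the prime ideal stay outside it.\<close>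

lemma ex_maximal_primitive:
  assumes "primitive p M0"
  obtains M where "primitive p M" "\<And>N. primitive p N \<Longrightarrow> M \<subseteq> N \<Longrightarrow> N = M"
proof -
  have "\<exists>M\<in>Collect (primitive p). \<forall>N\<in>Collect (primitive p). M \<subseteq> N \<longrightarrow> N = M"
  proof (rule subset_Zorn_nonempty)
    show "Collect (primitive p) \<noteq> {}" using assms by blast
  next
    fix \<C> assume ne: "\<C> \<noteq> {}" and ch: "subset.chain (Collect (primitive p)) \<C>"
    have prim: "primitive p N" if "N \<in> \<C>" for N
      using that ch unfolding subset_chain_def by blast
    \<comment> \<open>An empty chain would break this equation, since \<open>adic p {}\<close> still
      contains \<open>\<zero>\<close>.\<close>
    have un: "adic p (\<Union>\<C>) = (\<Union>N\<in>\<C>. adic p N)"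
      using ne unfolding adic_def by blast
    have total: "N1 \<subseteq> N2 \<or> N2 \<subseteq> N1" if "N1 \<in> \<C>" "N2 \<in> \<C>" for N1 N2
      using that ch unfolding subset_chain_def by blast
    have dir: "\<exists>N\<in>\<C>. a \<in> N \<and> b \<in> N" if "a \<in> \<Union>\<C>" "b \<in> \<Union>\<C>" for a b
      using that total by blast
    have dir_adic: "\<exists>N\<in>\<C>. a \<in> adic p N \<and> b \<in> adic p N"
      if ab: "a \<in> adic p (\<Union>\<C>)" "b \<in> adic p (\<Union>\<C>)" for a b
    proof -
      obtain N1 N2 where N: "N1 \<in> \<C>" "N2 \<in> \<C>" "a \<in> adic p N1" "b \<in> adic p N2"
        using ab unfolding un by blast
      with total[OF N(1,2)] show ?thesis
        using adic_mono[of N1 N2 p] adic_mono[of N2 N1 p] by blast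
    qed
    have "primitive p (\<Union>\<C>)"
      unfolding primitive_def
    proof (intro conjI ballI)
      show "\<Union>\<C> \<subseteq> carrier R" "\<one> \<in> \<Union>\<C>"
        using prim ne unfolding primitive_def by blast+
      show "a \<otimes> b \<in> \<Union>\<C>" if "a \<in> \<Union>\<C>" "b \<in> \<Union>\<C>" for a b
        using dir[OF that] prim unfolding primitive_def by blast
      show "a \<ominus> b \<in> adic p (\<Union>\<C>)" if "a \<in> adic p (\<Union>\<C>)" "b \<in> adic p (\<Union>\<C>)" for a b
        using dir_adic[OF that] prim unfolding primitive_def un by blast
      show "m \<noteq> p \<otimes> a" if m: "m \<in> \<Union>\<C>" "a \<in> adic p (\<Union>\<C>)" for m a
      proof -
        obtain N1 N2 where N: "N1 \<in> \<C>" "N2 \<in> \<C>" "m \<in> N1" "a \<in> adic p N2"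
          using m unfolding un by blast
        with total[OF N(1,2)] obtain N where "N \<in> \<C>" "m \<in> N" "a \<in> adic p N"
          using adic_mono[of N2 N1 p] by blast
        then show ?thesis using prim unfolding primitive_def by blast
      qed
    qed
    then show "\<Union>\<C> \<in> Collect (primitive p)" by blast
  qed
  then obtain M where "M \<in> Collect (primitive p)"
    "\<forall>N\<in>Collect (primitive p). M \<subseteq> N \<longrightarrow> N = M" by (rule bexE)
  then show thesis by (intro that[of M]) simp_all
qed

section \<open>Arithmetic of the ring \<open>adic p M\<close> when \<open>p\<close> is a unit of
  \<open>R\<close>\<close>

context
  fixes p q
  assumes p: "p \<in> carrier R" and q: "q \<in> carrier R" and pq: "p \<otimes> q = \<one>"
begin

lemma p_cancel: "a \<in> carrier R \<Longrightarrow> b \<in> carrier R \<Longrightarrow> p \<otimes> a = p \<otimes> b \<Longrightarrow> a = b"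
  using p q pq Units_l_cancel[of p a b] m_comm[of q p] unfolding Units_def by auto

lemma p_pow_cancel:
  "a \<in> carrier R \<Longrightarrow> b \<in> carrier R \<Longrightarrow> p [^] (k::nat) \<otimes> a = p [^] k \<otimes> b \<Longrightarrow> a = b"
  by (induction k) (use p in \<open>auto simp: m_assoc m_lcomm dest: p_cancel[rotated 2]\<close>)

context
  fixes M
  assumes M: "primitive p M"
begin

lemma M_closed: "m \<in> M \<Longrightarrow> m \<in> carrier R"
  and M_one: "\<one> \<in> M"
  and M_mult: "a \<in> M \<Longrightarrow> b \<in> M \<Longrightarrow> a \<otimes> b \<in> M"
  and adic_minus: "c \<in> adic p M \<Longrightarrow> d \<in> adic p M \<Longrightarrow> c \<ominus> d \<in> adic p M"
  and M_not_multiple: "m \<in> M \<Longrightarrow> c \<in> adic p M \<Longrightarrow> m \<noteq> p \<otimes> c"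
  using M unfolding primitive_def by auto

lemma adicI: "m \<in> M \<Longrightarrow> p [^] (k::nat) \<otimes> m \<in> adic p M"
  unfolding adic_def by blast

lemma zero_adic: "\<zero> \<in> adic p M"
  unfolding adic_def by blast

lemma adic_closed: "a \<in> adic p M \<Longrightarrow> a \<in> carrier R"
  unfolding adic_def using p M_closed by auto

lemma M_adic: "m \<in> M \<Longrightarrow> m \<in> adic p M"
  using adicI[of m 0] M_closed by simp

lemma adic_uminus: "a \<in> adic p M \<Longrightarrow> \<ominus> a \<in> adic p M"
  using adic_minus[OF zero_adic, of a] adic_closed[of a] by (simp add: minus_eq)

lemma subring_adic: "subring (adic p M) R"
proof (rule subringI)
  show "a \<oplus> b \<in> adic p M" if "a \<in> adic p M" "b \<in> adic p M" for a b
    using adic_minus[OF that(1) adic_uminus[OF that(2)]] that[THEN adic_closed]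
    by (simp add: minus_eq)
  show "a \<otimes> b \<in> adic p M" if ab: "a \<in> adic p M" "b \<in> adic p M" for a b
  proof (cases "a = \<zero> \<or> b = \<zero>")
    case True
    then show ?thesis using ab adic_closed zero_adic by auto
  next
    case False
    then obtain i j :: nat and m n where mn: "m \<in> M" "n \<in> M" "a = p [^] i \<otimes> m" "b = p [^] j \<otimes> n"
      using ab unfolding adic_def by auto
    then have "a \<otimes> b = p [^] (i + j) \<otimes> (m \<otimes> n)"
      using p M_closed by (simp add: nat_pow_mult[symmetric] m_ac)
    then show ?thesis using adicI[OF M_mult[OF mn(1,2)]] by simp
  qed
qed (use adic_closed adic_uminus M_adic M_one in auto)

lemma adic_p_mult:
  assumes "a \<in> adic p M"
  shows "p \<otimes> a \<in> adic p M"
  using subringE(6)[OF subring_adic _ assms] adicI[OF M_one, of 1] p by simp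

lemma zero_notin_M: "\<zero> \<notin> M"
  using M_not_multiple[OF _ zero_adic] p by auto

lemma adic_cases:
  assumes "a \<in> adic p M"
  obtains "a \<in> M" | b where "b \<in> adic p M" "a = p \<otimes> b"
proof (cases "a = \<zero>")
  case True
  then show ?thesis using that(2)[OF zero_adic] p by simp
next
  case False
  then obtain k :: nat and m where m: "m \<in> M" "a = p [^] k \<otimes> m"
    using assms unfolding adic_def by auto
  show ?thesis
  proof (cases k)
    case 0
    then show ?thesis using that(1) m M_closed by simp
  next
    case (Suc j)
    have "a = p \<otimes> (p [^] j \<otimes> m)" using m Suc p M_closed by (simp add: m_ac)
    then show ?thesis using that(2) adicI[OF m(1)] by blast
  qed
qed

text \<open>An element of the ring outside \<open>M\<close> is a multiple of \<open>p\<close>. If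
  the sum were one, its difference with \<open>p a\<close>, which is \<open>m\<close>, would be one
  too.\<close>

lemma M_add: "m \<in> M \<Longrightarrow> a \<in> adic p M \<Longrightarrow> m \<oplus> p \<otimes> a \<in> M"
proof -
  assume m: "m \<in> M" and a: "a \<in> adic p M"
  have "m \<oplus> p \<otimes> a \<in> adic p M"
    by (rule subringE(7)[OF subring_adic M_adic[OF m] adic_p_mult[OF a]])
  then show ?thesis
  proof (cases rule: adic_cases)
    case (2 b)
    have "m = (m \<oplus> p \<otimes> a) \<ominus> p \<otimes> a"
      using M_closed[OF m] adic_closed[OF a] p by algebra
    also have "\<dots> = p \<otimes> (b \<ominus> a)"
      unfolding 2 using adic_closed[OF 2(1)] adic_closed[OF a] p by algebra
    finally show ?thesis using M_not_multiple[OF m adic_minus[OF 2(1) a]] by blast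
  qed
qed

section \<open>Primitive polynomials over \<open>adic p M\<close>, Gauss's lemma and
  contents\<close>

text \<open>The values at \<open>r\<close> of the polynomials over \<open>adic p M\<close> with some coefficient in \<open>M\<close>.\<close>
inductive_set primitive_values :: "'a \<Rightarrow> 'a set" for r where
  unit: "m \<in> M \<Longrightarrow> f \<in> (\<Union>n. polys (adic p M) r n) \<Longrightarrow> m \<oplus> r \<otimes> f \<in> primitive_values r"
| multiple: "a \<in> adic p M \<Longrightarrow> f \<in> primitive_values r \<Longrightarrow> p \<otimes> a \<oplus> r \<otimes> f \<in> primitive_values r"

context
  fixes r
  assumes r: "r \<in> carrier R"
begin

abbreviation adic_adjoin where "adic_adjoin \<equiv> (\<Union>n. polys (adic p M) r n)"

lemmas subring_adic_adjoin = subring_polys[OF subring_adic r]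
lemmas adic_adjoin_ops = subringE(2,3,5,6,7)[OF subring_adic_adjoin]

lemma adic_mem_adjoin: "a \<in> adic p M \<Longrightarrow> a \<in> adic_adjoin"
  using subset_polys[OF subring_adic r] by blast

lemma adic_adjoin_closed: "f \<in> adic_adjoin \<Longrightarrow> f \<in> carrier R"
  using subringE(1)[OF subring_adic_adjoin] by blast

lemma p_mem_adjoin: "p \<in> adic_adjoin"
  using adic_mem_adjoin[OF adic_p_mult[OF M_adic[OF M_one]]] p by simp

lemma adic_adjoin_horner: "a \<in> adic p M \<Longrightarrow> f \<in> adic_adjoin \<Longrightarrow> a \<oplus> r \<otimes> f \<in> adic_adjoin"
  by (rule adic_adjoin_ops(5)[OF adic_mem_adjoin adic_adjoin_ops(4)[OF mem_polys[OF subring_adic r]]])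

lemma adic_adjoin_cases:
  assumes "f \<in> adic_adjoin"
  obtains a g where "a \<in> adic p M" "g \<in> adic_adjoin" "f = a \<oplus> r \<otimes> g"
proof -
  obtain n where n: "f \<in> polys (adic p M) r n" using assms by blast
  then have "f \<in> polys (adic p M) r (Suc n)" by (rule polys_Suc_mono[OF subring_adic r])
  then show thesis using that by auto
qed

lemma primitive_value_mem_adjoin: "f \<in> primitive_values r \<Longrightarrow> f \<in> adic_adjoin"
proof (induction rule: primitive_values.induct)
  case (unit m f)
  show ?case by (rule adic_adjoin_horner[OF M_adic[OF unit(1)] unit(2)])
next
  case (multiple a f)
  show ?case by (rule adic_adjoin_horner[OF adic_p_mult[OF multiple(1)] multiple.IH])
qed

text \<open>Each coefficient changes only by a multiple of \<open>p\<close>, and by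
  \<open>M_add\<close> this keeps a coefficient from \<open>M\<close> in \<open>M\<close>.\<close>

lemma primitive_values_add: "f \<in> primitive_values r \<Longrightarrow> g \<in> adic_adjoin \<Longrightarrow> f \<oplus> p \<otimes> g \<in> primitive_values r"
proof (induction arbitrary: g rule: primitive_values.induct)
  case (unit m f)
  from unit.prems obtain b h where b: "b \<in> adic p M" "h \<in> adic_adjoin" "g = b \<oplus> r \<otimes> h"
    by (rule adic_adjoin_cases)
  have "m \<oplus> r \<otimes> f \<oplus> p \<otimes> g = (m \<oplus> p \<otimes> b) \<oplus> r \<otimes> (f \<oplus> p \<otimes> h)"
    unfolding b using M_closed[OF unit(1)] adic_adjoin_closed[OF unit(2)] adic_closed[OF b(1)] adic_adjoin_closed[OF b(2)] p r
    by algebra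
  moreover have "f \<oplus> p \<otimes> h \<in> adic_adjoin" by (intro adic_adjoin_ops(4,5) p_mem_adjoin b unit)
  ultimately show ?case using primitive_values.unit[OF M_add[OF unit(1) b(1)]] by metis
next
  case (multiple a f)
  from multiple.prems obtain b h where b: "b \<in> adic p M" "h \<in> adic_adjoin" "g = b \<oplus> r \<otimes> h"
    by (rule adic_adjoin_cases)
  have "p \<otimes> a \<oplus> r \<otimes> f \<oplus> p \<otimes> g = p \<otimes> (a \<oplus> b) \<oplus> r \<otimes> (f \<oplus> p \<otimes> h)"
    unfolding b using adic_closed[OF multiple(1)] adic_adjoin_closed[OF primitive_value_mem_adjoin[OF multiple(2)]]
      adic_closed[OF b(1)] adic_adjoin_closed[OF b(2)] p r
    by algebra
  then show ?case
    using primitive_values.multiple[OF subringE(7)[OF subring_adic multiple(1) b(1)] multiple.IH[OF b(2)]]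
    by simp
qed

text \<open>Gauss's lemma.\<close>
lemma primitive_values_mult: "f \<in> primitive_values r \<Longrightarrow> g \<in> primitive_values r \<Longrightarrow> f \<otimes> g \<in> primitive_values r"
proof (induction arbitrary: g rule: primitive_values.induct)
  case (unit m f)
  note c = M_closed[OF unit(1)] adic_adjoin_closed[OF unit(2)] p r
  from unit.prems show ?case
  proof (induction rule: primitive_values.induct)
    case u: (unit m' f')
    have "(m \<oplus> r \<otimes> f) \<otimes> (m' \<oplus> r \<otimes> f') = m \<otimes> m' \<oplus> r \<otimes> (m \<otimes> f' \<oplus> f \<otimes> (m' \<oplus> r \<otimes> f'))"
      using c M_closed[OF u(1)] adic_adjoin_closed[OF u(2)] by algebra
    moreover have "m \<otimes> f' \<oplus> f \<otimes> (m' \<oplus> r \<otimes> f') \<in> adic_adjoin"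
      by (intro adic_adjoin_ops(4,5) adic_adjoin_horner adic_mem_adjoin M_adic u unit(1,2))
    ultimately show ?case using primitive_values.unit[OF M_mult[OF unit(1) u(1)]] by metis
  next
    case mu: (multiple b g)
    \<comment> \<open>The constant coefficient of the product is divisible by \<open>p\<close>. What
      follows it is the product with the shorter \<open>g\<close>, covered by the inner induction,
      up to a multiple of \<open>p\<close>.\<close>
    have "(m \<oplus> r \<otimes> f) \<otimes> (p \<otimes> b \<oplus> r \<otimes> g)
        = p \<otimes> (m \<otimes> b) \<oplus> r \<otimes> ((m \<oplus> r \<otimes> f) \<otimes> g \<oplus> p \<otimes> (b \<otimes> f))"
      using c adic_closed[OF mu(1)] adic_adjoin_closed[OF primitive_value_mem_adjoin[OF mu(2)]] by algebra
    moreover have "(m \<oplus> r \<otimes> f) \<otimes> g \<oplus> p \<otimes> (b \<otimes> f) \<in> primitive_values r"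
      by (intro primitive_values_add mu.IH adic_adjoin_ops(4) adic_mem_adjoin mu(1) unit(2))
    moreover have "m \<otimes> b \<in> adic p M"
      by (intro subringE(6)[OF subring_adic] M_adic unit(1) mu(1))
    ultimately show ?case using primitive_values.multiple by metis
  qed
next
  case (multiple a f)
  obtain b h where b: "b \<in> adic p M" "h \<in> adic_adjoin" "g = b \<oplus> r \<otimes> h"
    using primitive_value_mem_adjoin[OF multiple.prems] by (rule adic_adjoin_cases)
  \<comment> \<open>The expansion \<open>b + r h\<close> is used only in the part with the factor
    \<open>p a\<close>; \<open>g\<close> stays whole next to \<open>f\<close>, so that the induction
    hypothesis applies to \<open>f g\<close>.\<close>
  have "(p \<otimes> a \<oplus> r \<otimes> f) \<otimes> g = p \<otimes> (a \<otimes> b) \<oplus> r \<otimes> (f \<otimes> g \<oplus> p \<otimes> (a \<otimes> h))"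
    unfolding b using adic_closed[OF multiple(1)] adic_adjoin_closed[OF primitive_value_mem_adjoin[OF multiple(2)]]
      adic_closed[OF b(1)] adic_adjoin_closed[OF b(2)] p r
    by algebra
  moreover have "f \<otimes> g \<oplus> p \<otimes> (a \<otimes> h) \<in> primitive_values r"
    by (intro primitive_values_add multiple.IH multiple.prems adic_adjoin_ops(4) adic_mem_adjoin multiple(1) b(2))
  moreover have "a \<otimes> b \<in> adic p M"
    by (rule subringE(6)[OF subring_adic multiple(1) b(1)])
  ultimately show ?case using primitive_values.multiple by metis
qed

lemma M_primitive_value: "m \<in> M \<Longrightarrow> m \<in> primitive_values r"
  using primitive_values.unit[OF _ adic_adjoin_ops(1), of m] M_closed[of m] r by simp

lemma p_pow_mem_adjoin: "p [^] (k::nat) \<in> adic_adjoin"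
  by (induction k) (use adic_adjoin_ops(2) adic_adjoin_ops(4)[OF _ p_mem_adjoin] in \<open>simp_all del: UN_iff\<close>)

text \<open>A nonzero polynomial is its content, a power of \<open>p\<close>, times a primitive
  polynomial. Thus the set of primitive values encodes the ring obtained by adjoining
  \<open>r\<close>.\<close>

lemma adic_primitive_values: "adic p (primitive_values r) = adic_adjoin"
proof
  have "p [^] k \<otimes> f \<in> adic_adjoin" if "f \<in> primitive_values r" for k :: nat and f
    by (rule adic_adjoin_ops(4)[OF p_pow_mem_adjoin primitive_value_mem_adjoin[OF that]])
  with adic_adjoin_ops(1) show "adic p (primitive_values r) \<subseteq> adic_adjoin"
    unfolding adic_def[of p "primitive_values r"] by blast
next
  have "f \<in> polys (adic p M) r n \<Longrightarrow> f \<in> adic p (primitive_values r)" for f n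
  proof (induction n arbitrary: f)
    case (Suc n)
    then obtain a g where ag: "a \<in> adic p M" "g \<in> polys (adic p M) r n" "f = a \<oplus> r \<otimes> g" by auto
    from ag(2) have gP: "g \<in> adic_adjoin" by blast
    note c = adic_closed[OF ag(1)] adic_adjoin_closed[OF gP] p r
    have ext: "p [^] k \<otimes> h \<in> adic p (primitive_values r)" if "h \<in> primitive_values r" for k :: nat and h
      using that unfolding adic_def by blast
    consider "g = \<zero>" "a = \<zero>"
      | (m) k :: nat and m where "m \<in> M" "a = p [^] k \<otimes> m" "g = \<zero>"
      | (n) k :: nat and h where "h \<in> primitive_values r" "g = p [^] k \<otimes> h" "a = \<zero>"
      | (mn) i j :: nat and m h where "m \<in> M" "a = p [^] i \<otimes> m" "h \<in> primitive_values r" "g = p [^] j \<otimes> h"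
      using ag(1) Suc.IH[OF ag(2)] unfolding adic_def by blast
    then show ?case
    proof cases
      case 1
      then show ?thesis using ag r by (simp add: adic_def)
    next
      case m
      then show ?thesis using ag c ext[OF M_primitive_value[OF m(1)]] by simp
    next
      case (n k h)
      have "f = p [^] k \<otimes> (p \<otimes> \<zero> \<oplus> r \<otimes> h)"
        using ag n c adic_adjoin_closed[OF primitive_value_mem_adjoin[OF n(1)]] by (simp add: m_lcomm)
      then show ?thesis using ext[OF primitive_values.multiple[OF zero_adic n(1)]] by simp
    next
      case (mn i j m h)
      note cm = M_closed[OF mn(1)] adic_adjoin_closed[OF primitive_value_mem_adjoin[OF mn(3)]]
      show ?thesis
      proof (cases "i \<le> j")
        \<comment> \<open>The constant term carries the smaller power of \<open>p\<close>; after
          \<open>p^i\<close> is taken out, its coefficient \<open>m\<close> lies in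
          \<open>M\<close>.\<close>
        case True
        define y z where "y = p [^] i" and "z = p [^] (j - i)"
        have yz: "y \<in> carrier R" "z \<in> carrier R" using p by (simp_all add: y_def z_def)
        have "p [^] j = y \<otimes> z"
          unfolding y_def z_def using p True by (simp add: nat_pow_mult)
        then have "f = y \<otimes> (m \<oplus> r \<otimes> (z \<otimes> h))"
          unfolding ag mn(2,4) y_def[symmetric] using cm r yz by algebra
        moreover have "z \<otimes> h \<in> adic_adjoin"
          unfolding z_def by (intro adic_adjoin_ops(4) p_pow_mem_adjoin primitive_value_mem_adjoin mn(3))
        ultimately show ?thesis
          unfolding y_def using ext[OF primitive_values.unit[OF mn(1)]] by metis
      next
        \<comment> \<open>Now \<open>p^j\<close> is taken out. Since \<open>i > j\<close>, a factor
          \<open>p\<close> remains in the constant coefficient; it is split off for the rule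
          \<open>multiple\<close>, hence the exponent \<open>i - Suc j\<close>.\<close>
        case False
        define y z where "y = p [^] j" and "z = p [^] (i - Suc j)"
        have yz: "y \<in> carrier R" "z \<in> carrier R" using p by (simp_all add: y_def z_def)
        have "i = j + Suc (i - Suc j)" using False by simp
        then have "p [^] i = p [^] j \<otimes> p [^] Suc (i - Suc j)"
          using p by (metis nat_pow_mult)
        then have "p [^] i = y \<otimes> (z \<otimes> p)"
          unfolding y_def z_def by simp
        then have "f = y \<otimes> (p \<otimes> (z \<otimes> m) \<oplus> r \<otimes> h)"
          unfolding ag mn(2,4) y_def[symmetric] using cm r p yz by algebra
        moreover have "z \<otimes> m \<in> adic p M"
          unfolding z_def by (rule adicI[OF mn(1)])
        ultimately show ?thesis
          unfolding y_def using ext[OF primitive_values.multiple[OF _ mn(3)]] by metis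
      qed
    qed
  qed (simp add: adic_def)
  then show "adic_adjoin \<subseteq> adic p (primitive_values r)" by blast
qed

text \<open>The hypothesis is what excludes \<open>f = p g\<close>: by
  \<open>primitive_values_add\<close>, such an \<open>f\<close> would make
  \<open>f - p g = \<zero>\<close> a primitive value.\<close>

lemma primitive_primitive_values: "\<zero> \<notin> primitive_values r \<Longrightarrow> primitive p (primitive_values r)"
  unfolding primitive_def adic_primitive_values
proof (intro conjI ballI)
  assume z: "\<zero> \<notin> primitive_values r"
  show "primitive_values r \<subseteq> carrier R" using primitive_value_mem_adjoin adic_adjoin_closed by blast
  show "\<one> \<in> primitive_values r" by (rule M_primitive_value[OF M_one])
  show "f \<otimes> g \<in> primitive_values r" if "f \<in> primitive_values r" "g \<in> primitive_values r" for f g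
    by (rule primitive_values_mult[OF that])
  show "f \<ominus> g \<in> adic_adjoin" if "f \<in> adic_adjoin" "g \<in> adic_adjoin" for f g
    unfolding minus_eq by (intro adic_adjoin_ops(3,5) that)
  show "f \<noteq> p \<otimes> g" if "f \<in> primitive_values r" "g \<in> adic_adjoin" for f g
  proof
    assume eq: "f = p \<otimes> g"
    have "f \<oplus> p \<otimes> (\<ominus> g) = \<zero>"
      unfolding eq using p adic_adjoin_closed[OF that(2)] by algebra
    then show False using z primitive_values_add[OF that(1) adic_adjoin_ops(3)[OF that(2)]] by simp
  qed
qed

text \<open>This is the algebraicity of \<open>r\<close>: if no primitive polynomial vanished at
  \<open>r\<close>, the primitive values would form a primitive set above \<open>M\<close>, hence
  equal to \<open>M\<close>.\<close>

lemma zero_primitive_value: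
  assumes "\<And>M'. primitive p M' \<Longrightarrow> M \<subseteq> M' \<Longrightarrow> M' = M"
  shows "\<zero> \<in> primitive_values r"
proof (rule ccontr)
  assume z: "\<zero> \<notin> primitive_values r"
  from assms[OF primitive_primitive_values[OF z]] M_primitive_value have eq: "primitive_values r = M" by blast
  \<comment> \<open>The polynomial \<open>X\<close> is primitive, so its value \<open>r\<close> lies
    in \<open>M\<close>. Then \<open>r - X\<close> is primitive as well, with constant coefficient
    \<open>r\<close>, and it vanishes at \<open>r\<close>.\<close>
  have "p \<otimes> \<zero> \<oplus> r \<otimes> \<one> \<in> primitive_values r"
    by (intro primitive_values.multiple zero_adic M_primitive_value M_one)
  then have rM: "r \<in> M" unfolding eq using p r by simp
  have "r \<oplus> r \<otimes> (\<ominus> \<one>) \<in> primitive_values r"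
    by (intro primitive_values.unit rM adic_adjoin_ops(3) adic_adjoin_ops(2))
  moreover have "r \<oplus> r \<otimes> (\<ominus> \<one>) = \<zero>" using r by algebra
  ultimately show False using z by simp
qed

section \<open>Leading coefficients, and integrality of a multiple \<open>p^k r\<close> up to a
  factor from \<open>M\<close>\<close>

text \<open>Some polynomial with value \<open>f\<close> at \<open>r\<close> has leading term
  \<open>p^k u X^d\<close>; \<open>l\<close> is the negative of its lower part. As only values are
  recorded, \<open>f = \<zero>\<close> is allowed and then expresses an algebraic relation for
  \<open>r\<close>.\<close>

definition has_leading_term :: "'a \<Rightarrow> bool" where
  "has_leading_term f \<longleftrightarrow> (\<exists>(k::nat) (d::nat) u l. u \<in> M \<and> l \<in> polys (adic p M) r d \<and>
     p [^] k \<otimes> u \<otimes> r [^] d = f \<oplus> l)"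

lemma has_leading_term_const:
  assumes "u \<in> M"
  shows "has_leading_term (p [^] (k::nat) \<otimes> u)"
  unfolding has_leading_term_def
  by (rule exI[of _ k], rule exI[of _ 0], rule exI[of _ u], rule exI[of _ \<zero>])
    (use assms M_closed[OF assms] p r in simp)

lemma has_leading_term_step:
  assumes a: "a \<in> adic p M" and g: "g \<in> carrier R" "has_leading_term g"
  shows "has_leading_term (a \<oplus> r \<otimes> g)"
proof -
  obtain k d :: nat and u l
    where u: "u \<in> M" "l \<in> polys (adic p M) r d" "p [^] k \<otimes> u \<otimes> r [^] d = g \<oplus> l"
    using g(2) unfolding has_leading_term_def by blast
  have l: "l \<in> carrier R" by (rule polys_closed[OF subring_adic r u(2)])
  note c = adic_closed[OF a] g(1) p r
  have "p [^] k \<otimes> u \<otimes> r [^] Suc d = r \<otimes> (p [^] k \<otimes> u \<otimes> r [^] d)"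
    using c M_closed[OF u(1)] by (simp add: m_ac)
  also have "\<dots> = (a \<oplus> r \<otimes> g) \<oplus> (\<ominus> a \<oplus> r \<otimes> l)"
    unfolding u(3) using c l by algebra
  finally show ?thesis
    unfolding has_leading_term_def
    using u(1) polys_SucI[OF adic_uminus[OF a] u(2)] by blast
qed

lemma zero_or_has_leading_term:
  "f \<in> polys (adic p M) r n \<Longrightarrow> f = \<zero> \<or> has_leading_term f"
proof (induction n arbitrary: f)
  case (Suc n)
  then obtain a g where ag: "a \<in> adic p M" "g \<in> polys (adic p M) r n" "f = a \<oplus> r \<otimes> g" by auto
  note g = polys_closed[OF subring_adic r ag(2)]
  from Suc.IH[OF ag(2)] show ?case
  proof
    assume "g = \<zero>"
    then have "f = a" using ag adic_closed[OF ag(1)] r by simp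
    then show ?thesis using ag(1) has_leading_term_const unfolding adic_def by blast
  next
    assume "has_leading_term g"
    from has_leading_term_step[OF ag(1) g this] show ?thesis unfolding ag by blast
  qed
qed simp

text \<open>A coefficient in \<open>M\<close> keeps the polynomial from being zero even where its
  value is zero, so the exception of \<open>zero_or_has_leading_term\<close> disappears.\<close>

lemma primitive_value_has_leading_term: "f \<in> primitive_values r \<Longrightarrow> has_leading_term f"
proof (induction rule: primitive_values.induct)
  case (unit m f)
  then obtain n where "f \<in> polys (adic p M) r n" by blast
  then consider "f = \<zero>" | "has_leading_term f" using zero_or_has_leading_term by blast
  then show ?case
  proof cases
    case 1
    then show ?thesis using has_leading_term_const[OF unit(1), of 0] M_closed[OF unit(1)] r by simp
  next
    case 2
    then show ?thesis by (intro has_leading_term_step M_adic unit adic_adjoin_closed)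
  qed
next
  case (multiple a f)
  then show ?case by (intro has_leading_term_step adic_p_mult adic_adjoin_closed primitive_value_mem_adjoin)
qed

end

text \<open>Termwise, \<open>c^n a x^i = c^(n - i) a (c x)^i\<close> for
  \<open>i \<le> n\<close>.\<close>

lemma polys_rescale:
  assumes S: "subring S R" and x: "x \<in> carrier R" and c: "c \<in> S"
  shows "l \<in> polys S x (Suc n) \<Longrightarrow> c [^] n \<otimes> l \<in> polys S (c \<otimes> x) (Suc n)"
proof (induction n arbitrary: l)
  case 0
  then have "l \<in> S" using x subring_closed[OF S] by auto
  then show ?case using polys_const[OF S, of "c \<otimes> x" l 0] subring_closed[OF S] c x by simp
next
  case (Suc n)
  obtain a f where f: "a \<in> S" "f \<in> polys S x (Suc n)" "l = a \<oplus> x \<otimes> f"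
    using Suc.prems polys.simps(2)[of S x "Suc n"] by blast
  have cl: "c \<in> carrier R" "a \<in> carrier R" "f \<in> carrier R" "c [^] n \<in> carrier R"
    using subring_closed[OF S c] subring_closed[OF S f(1)] polys_closed[OF S x f(2)] by simp_all
  have "c [^] Suc n \<otimes> l = c [^] Suc n \<otimes> a \<oplus> (c \<otimes> x) \<otimes> (c [^] n \<otimes> f)"
    unfolding f(3) nat_pow_Suc using cl x by algebra
  moreover have "c [^] i \<in> S" for i :: nat
    by (induction i) (auto intro: subringE(3,6)[OF S] c)
  ultimately show ?case
    using polys_SucI[OF _ Suc.IH[OF f(2)]] subringE(6)[OF S _ f(1)] by metis
qed

text \<open>The usual passage from an algebraic to an integral element: multiplying
  \<open>p^k u r^d = l\<close> by \<open>p^(k (d - 1))\<close> absorbs the power of \<open>p\<close>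
  into \<open>r\<close>, leaving the leading coefficient \<open>u\<close>.\<close>

lemma ex_integral_multiple:
  assumes max: "\<And>M'. primitive p M' \<Longrightarrow> M \<subseteq> M' \<Longrightarrow> M' = M" and r: "r \<in> carrier R"
  obtains k n :: nat and u where "u \<in> M"
    "u \<otimes> (p [^] k \<otimes> r) [^] n \<in> polys (adic p M) (p [^] k \<otimes> r) n"
proof -
  obtain k d :: nat and u l
    where u: "u \<in> M" "l \<in> polys (adic p M) r d" "p [^] k \<otimes> u \<otimes> r [^] d = \<zero> \<oplus> l"
    using primitive_value_has_leading_term[OF r zero_primitive_value[OF r max]] unfolding has_leading_term_def[OF r] by blast
  note l = polys_closed[OF subring_adic r u(2)] and uc = M_closed[OF u(1)]
  have eq: "p [^] k \<otimes> u \<otimes> r [^] d = l" using u(3) l by simp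
  show thesis
  proof (cases d)
    \<comment> \<open>A relation of degree 0 would read \<open>p^k u = \<zero>\<close>, which is
      impossible as \<open>p\<close> cancels and \<open>\<zero>\<close> is not in
      \<open>M\<close>.\<close>
    case 0
    then have "p [^] k \<otimes> u = p [^] k \<otimes> \<zero>" using eq u(2) uc p by simp
    then have "u = \<zero>" using p_pow_cancel[of u \<zero> k] uc by simp
    then show ?thesis using zero_notin_M u(1) by blast
  next
    case (Suc n)
    define c where "c = p [^] k"
    have c: "c \<in> adic p M"
      using adicI[OF M_one, of k] p unfolding c_def by simp
    note cc = adic_closed[OF c]
    have "u \<otimes> (c \<otimes> r) [^] Suc n = c [^] n \<otimes> (c \<otimes> u \<otimes> r [^] Suc n)"
      using cc uc r by (simp add: nat_pow_distrib m_ac)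
    also have "\<dots> = c [^] n \<otimes> l" using eq unfolding Suc c_def by simp
    also have "\<dots> \<in> polys (adic p M) (c \<otimes> r) (Suc n)"
      using polys_rescale[OF subring_adic r c] u(2) Suc by blast
    finally show ?thesis using that[OF u(1), of k "Suc n"] unfolding c_def by blast
  qed
qed

end

section \<open>From a primitive set to a maximal subring\<close>

lemma submaximal_if_primitive:
  assumes "primitive p M0"
  shows "submaximal R"
proof -
  obtain M where M: "primitive p M" and max: "\<And>M'. primitive p M' \<Longrightarrow> M \<subseteq> M' \<Longrightarrow> M' = M"
    using ex_maximal_primitive[OF assms] by blast
  \<comment> \<open>Since \<open>q = 1/p\<close>, a subring avoids \<open>B\<close> exactly when no
    element of \<open>M\<close> is divisible by \<open>p\<close> in it.\<close>
  define B where "B = {m \<otimes> q | m. m \<in> M}"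
  note A = subring_adic[OF M]
  have pmq: "p \<otimes> (m \<otimes> q) = m" if "m \<in> carrier R" for m
    using that p q pq by (simp add: m_lcomm)
  have "adic p M \<inter> B = {}"
    using M_not_multiple[OF M] pmq M_closed[OF M] unfolding B_def by force
  from maximal_subring_avoiding[OF A this] obtain S where
    S: "subring S R" "adic p M \<subseteq> S" "S \<inter> B = {}"
    and Smax: "\<And>T. subring T R \<Longrightarrow> S \<subseteq> T \<Longrightarrow> T \<inter> B = {} \<Longrightarrow> T = S" by blast
  note Sc = subring_closed[OF S(1)] and Sops = subringE(2,3,5,6,7)[OF S(1)]
  have MS: "M \<subseteq> S" using M_adic[OF M] S(2) by blast
  have pS: "p \<in> S"
    using adic_p_mult[OF M M_adic[OF M M_one[OF M]]] p S(2) by auto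
  \<comment> \<open>Saturating \<open>M\<close> modulo \<open>p S\<close> gives the stability under
    adding multiples of \<open>p\<close> that \<open>integral_no_unit\<close> requires.\<close>
  define G where "G = {m \<oplus> p \<otimes> t | m t. m \<in> M \<and> t \<in> S}"
  have GI: "m \<oplus> p \<otimes> t \<in> G" if "m \<in> M" "t \<in> S" for m t
    using that unfolding G_def by blast
  have MG: "M \<subseteq> G"
    using GI[OF _ Sops(1)] M_closed[OF M] p by fastforce
  have GS: "G \<subseteq> S"
    unfolding G_def using MS by (auto intro!: Sops(4,5) pS)
  have Gmult: "g \<otimes> h \<in> G" if "g \<in> G" "h \<in> G" for g h
  proof -
    obtain m t n w where g: "m \<in> M" "t \<in> S" "g = m \<oplus> p \<otimes> t" "n \<in> M" "w \<in> S" "h = n \<oplus> p \<otimes> w"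
      using \<open>g \<in> G\<close> \<open>h \<in> G\<close> unfolding G_def by blast
    have "g \<otimes> h = m \<otimes> n \<oplus> p \<otimes> (m \<otimes> w \<oplus> t \<otimes> h)"
      unfolding g using M_closed[OF M g(1)] M_closed[OF M g(4)] Sc[OF g(2)] Sc[OF g(5)] p by algebra
    moreover have "m \<otimes> w \<oplus> t \<otimes> h \<in> S"
      using g(1,2,5) MS GS \<open>h \<in> G\<close> by (intro Sops(4,5)) auto
    ultimately show ?thesis using GI[OF M_mult[OF M g(1,4)]] by simp
  qed
  have Gadd: "g \<oplus> p \<otimes> a \<in> G" if "g \<in> G" "a \<in> S" for g a
  proof -
    obtain m t where g: "m \<in> M" "t \<in> S" "g = m \<oplus> p \<otimes> t"
      using \<open>g \<in> G\<close> unfolding G_def by blast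
    have "g \<oplus> p \<otimes> a = m \<oplus> p \<otimes> (t \<oplus> a)"
      unfolding g using M_closed[OF M g(1)] Sc[OF g(2)] Sc[OF that(2)] p by algebra
    then show ?thesis using GI[OF g(1) Sops(5)[OF g(2) that(2)]] by simp
  qed
  have avoid: "m \<noteq> p \<otimes> t" if "m \<in> M" "t \<in> S" for m t
  proof
    assume "m = p \<otimes> t"
    then have "p \<otimes> t = p \<otimes> (m \<otimes> q)"
      using pmq[OF M_closed[OF M that(1)]] by argo
    from p_cancel[OF _ _ this] have "t = m \<otimes> q"
      using M_closed[OF M that(1)] Sc[OF that(2)] q by simp
    then show False using S(3) that unfolding B_def by blast
  qed
  have G0: "\<zero> \<notin> G"
  proof
    assume "\<zero> \<in> G"
    then obtain m t where g: "m \<in> M" "t \<in> S" "\<zero> = m \<oplus> p \<otimes> t" unfolding G_def by blast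
    note c = M_closed[OF M g(1)] Sc[OF g(2)]
    have "m = (m \<oplus> p \<otimes> t) \<oplus> p \<otimes> (\<ominus> t)" using c p by algebra
    also have "\<dots> = p \<otimes> (\<ominus> t)" unfolding g(3)[symmetric] using c p by simp
    finally show False using avoid[OF g(1) Sops(3)[OF g(2)]] by blast
  qed
  have "\<exists>k::nat. p [^] k \<otimes> r \<in> S" if r: "r \<in> carrier R" for r
  proof -
    obtain k n :: nat and u where u: "u \<in> M"
      "u \<otimes> (p [^] k \<otimes> r) [^] n \<in> polys (adic p M) (p [^] k \<otimes> r) n"
      using ex_integral_multiple[OF M max r] by blast
    define x where "x = p [^] k \<otimes> r"
    have x: "x \<in> carrier R" using p r by (simp add: x_def)
    have ux: "u \<otimes> x [^] n \<in> polys S x n"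
      using u(2) polys_mono_coeffs[OF S(2)] unfolding x_def by blast
    define T where "T = (\<Union>n. polys S x n)"
    \<comment> \<open>If \<open>m q = b + x f\<close> lay in \<open>T\<close>, multiplying by
      \<open>p\<close> would give \<open>m - p b = p x f\<close> with \<open>m - p b\<close> in
      \<open>G\<close>, contrary to \<open>integral_no_unit\<close> applied with \<open>u\<close>
      and the integral relation for \<open>x\<close>. Maximality of \<open>S\<close> then forces
      \<open>x\<close> into \<open>S\<close>.\<close>
    have "T \<inter> B = {}"
    proof (rule ccontr)
      assume "T \<inter> B \<noteq> {}"
      then obtain m j where m: "m \<in> M" "m \<otimes> q \<in> polys S x j" unfolding T_def B_def by blast
      have "m \<otimes> q \<in> polys S x (Suc j)" by (rule polys_Suc_mono[OF S(1) x m(2)])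
      then obtain b f where b: "b \<in> S" "f \<in> polys S x j" "m \<otimes> q = b \<oplus> x \<otimes> f" by auto
      note c = M_closed[OF M m(1)] Sc[OF b(1)] polys_closed[OF S(1) x b(2)] p x
      have "m \<oplus> p \<otimes> (\<ominus> b) = p \<otimes> (m \<otimes> q) \<oplus> p \<otimes> (\<ominus> b)" using pmq c by simp
      also have "\<dots> = p \<otimes> x \<otimes> f" unfolding b(3) using c by algebra
      finally show False
        using integral_no_unit[OF S(1) x pS GS Gmult Gadd G0 _ ux GI[OF m(1) Sops(3)[OF b(1)]] b(2)]
          u(1) MG by blast
    qed
    then have "T = S"
      using Smax[of T] subring_polys[OF S(1) x] subset_polys[OF S(1) x] unfolding T_def by blast
    then show ?thesis using mem_polys[OF S(1) x] unfolding T_def x_def by blast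
  qed
  moreover have "q \<notin> S"
    using avoid[OF M_one[OF M], of q] pq by auto
  ultimately show ?thesis
    using submaximal_if_localization[OF p q pq S(1)] by blast
qed

end

section \<open>The integers in \<open>R\<close> as the initial primitive set, and the
  conclusion\<close>

lemma add_pow_one_mult: "[a] \<cdot> \<one> \<otimes> [b] \<cdot> \<one> = [(a * b)] \<cdot> \<one>" for a b :: int
proof -
  have "[a] \<cdot> \<one> \<otimes> [b] \<cdot> \<one> = [b] \<cdot> ([a] \<cdot> \<one>)"
    by (subst add_pow_rdistr_int) simp_all
  then show ?thesis using add.int_pow_pow[of \<one> b a] by simp
qed

lemma add_pow_one_minus: "[a] \<cdot> \<one> \<ominus> [b] \<cdot> \<one> = [(a - b)] \<cdot> \<one>" for a b :: int
  using add.int_pow_diff[of \<one> a b] by (simp add: minus_eq)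

lemma add_pow_one_pow: "([a] \<cdot> \<one>) [^] k = [(a ^ k)] \<cdot> \<one>" for a :: int and k :: nat
  by (induction k) (simp_all add: add_pow_one_mult mult.commute add_pow_int_ge)

text \<open>In characteristic 0 the integers embed in \<open>R\<close>, so non-divisibility by
  \<open>p\<close> is preserved. Splitting off the full power of \<open>p\<close> from a nonzero
  integer shows that the encoded ring is the image of the integers; primality makes the set
  multiplicative.\<close>

lemma primitive_integers:
  fixes p :: int
  assumes char: "ring_char R = 0" and p: "Factorial_Ring.prime p"
  shows "primitive ([p] \<cdot> \<one>) {[z] \<cdot> \<one> | z :: int. \<not> p dvd z}"
proof -
  define M where "M = {[z] \<cdot> \<one> | z :: int. \<not> p dvd z}"
  have MI: "[z] \<cdot> \<one> \<in> M" if "\<not> p dvd z" for z :: int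
    using that unfolding M_def by blast
  have inj0: "z = 0" if "[z] \<cdot> \<one> = \<zero>" for z :: int
  proof (rule ccontr)
    assume "z \<noteq> 0"
    have "[\<bar>z\<bar>] \<cdot> \<one> = \<zero>"
      using that add.int_pow_neg[of \<one> z] by (simp add: abs_if)
    then have "[(nat \<bar>z\<bar>)] \<cdot> \<one> = \<zero>" by (simp add: add_pow_int_ge)
    then show False using char \<open>z \<noteq> 0\<close> ring_char_eq_0_iff[OF ring_axioms] by simp
  qed
  have inj: "a = b" if "[a] \<cdot> \<one> = [b] \<cdot> \<one>" for a b :: int
    using inj0[of "a - b"] that add_pow_one_minus[of a b] by (simp add: r_neg minus_eq)
  have adic: "adic ([p] \<cdot> \<one>) M = range (\<lambda>z::int. [z] \<cdot> \<one>)"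
  proof
    have "([p] \<cdot> \<one>) [^] k \<otimes> m \<in> range (\<lambda>z::int. [z] \<cdot> \<one>)" if "m \<in> M" for k :: nat and m
      using that by (auto simp: M_def add_pow_one_pow add_pow_one_mult)
    moreover have "\<zero> = [(0::int)] \<cdot> \<one>" by (simp add: add_pow_int_ge)
    ultimately show "adic ([p] \<cdot> \<one>) M \<subseteq> range (\<lambda>z::int. [z] \<cdot> \<one>)"
      unfolding adic_def by blast
  next
    have "[z] \<cdot> \<one> \<in> adic ([p] \<cdot> \<one>) M" for z :: int
    proof (cases "z = 0")
      case True
      then show ?thesis by (simp add: adic_def add_pow_int_ge)
    next
      case False
      obtain w where w: "z = p ^ multiplicity p z * w" "\<not> p dvd w"
        using multiplicity_decompose'[OF False] not_prime_unit p by blast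
      then have "[z] \<cdot> \<one> = ([p] \<cdot> \<one>) [^] multiplicity p z \<otimes> [w] \<cdot> \<one>"
        by (simp add: add_pow_one_pow add_pow_one_mult)
      then show ?thesis using MI[OF w(2)] unfolding adic_def by blast
    qed
    then show "range (\<lambda>z::int. [z] \<cdot> \<one>) \<subseteq> adic ([p] \<cdot> \<one>) M" by blast
  qed
  have "primitive ([p] \<cdot> \<one>) M"
    unfolding primitive_def adic
  proof (intro conjI ballI)
    show "M \<subseteq> carrier R" unfolding M_def by auto
    show "\<one> \<in> M" using MI[of 1] not_prime_unit[of p] p by (auto simp: add_pow_int_ge)
    show "a \<otimes> b \<in> M" if "a \<in> M" "b \<in> M" for a b
      using that p by (auto simp: M_def add_pow_one_mult prime_dvd_mult_iff)
    show "a \<ominus> b \<in> range (\<lambda>z::int. [z] \<cdot> \<one>)"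
      if "a \<in> range (\<lambda>z::int. [z] \<cdot> \<one>)" "b \<in> range (\<lambda>z::int. [z] \<cdot> \<one>)" for a b
      using that by (auto simp: add_pow_one_minus)
    show "m \<noteq> [p] \<cdot> \<one> \<otimes> a" if "m \<in> M" "a \<in> range (\<lambda>z::int. [z] \<cdot> \<one>)" for m a
      using that by (auto simp: M_def add_pow_one_mult dest!: inj)
  qed
  then show ?thesis unfolding M_def .
qed

end

theorem corollary1p5:
  fixes R (structure)
  assumes "cring R" and "\<one> \<noteq> \<zero>"
    and "ring_char R = 0"
    and "\<exists>n::nat. n > 1 \<and> [n] \<cdot> \<one> \<in> Units R"
  shows "submaximal R"
proof -
  interpret cring R by fact
  obtain n :: nat where n: "n > 1" "[n] \<cdot> \<one> \<in> Units R" using assms(4) by blast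
  obtain p :: nat where p: "Factorial_Ring.prime p" "p dvd n" using prime_factor_nat[of n] n(1) by auto
  then obtain m where "n = p * m" by blast
  then have "[n] \<cdot> \<one> = [(int p * int m)] \<cdot> \<one>"
    by (simp add: add_pow_int_ge nat_mult_distrib)
  then have "[n] \<cdot> \<one> = [(int p)] \<cdot> \<one> \<otimes> [(int m)] \<cdot> \<one>"
    by (simp only: add_pow_one_mult)
  \<comment> \<open>With \<open>n = p m\<close>, the inverse of \<open>p\<close> is
    \<open>m/n\<close>.\<close>
  then have inv_p: "[(int p)] \<cdot> \<one> \<otimes> ([(int m)] \<cdot> \<one> \<otimes> inv ([n] \<cdot> \<one>)) = \<one>"
    using Units_r_inv[OF n(2)] Units_inv_closed[OF n(2)] by (simp add: m_assoc)
  show ?thesis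
    by (rule submaximal_if_primitive[OF _ _ inv_p primitive_integers[OF assms(3)]])
      (use p Units_inv_closed[OF n(2)] in simp_all)
qed

end
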